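(* Let $ABC$ be a triangle with incenter $I$, let $0<\theta<360^\circ$, and assume that every angle of $\triangle ABC$ is less than $180^\circ-\frac{\theta}{2}$. Let $\gamma_a,\gamma_b,\gamma_c$ be the general triad of circles associated with $\triangle ABC$ and $\theta$. Then the six points at which these circles touch the sides of $\triangle ABC$ (the points where $\gamma_a$ touches $AB$ and $AC$, where $\gamma_b$ touches $BC$ and $BA$, and where $\gamma_c$ touches $CA$ and $CB$) lie on a circle with center $I$.
   Context: General triad of circles: $\omega_a$ is the circular arc of angular measure $\theta$ with endpoints $B$ and $C$ erected internally on side $BC$ (i.e. lying on the same side of line $BC$ as $A$); $\omega_b$ (on $CA$) and $\omega_c$ (on $AB$) are defined similarly with the same angular measure $\theta$. $\gamma_a$ is the circle inside $\triangle ABC$, tangent to sides $AB$ and $AC$ and externally tangent to $\omega_a$; $\gamma_b,\gamma_c$ are defined similarly. The assumption that all angles are less than $180^\circ-\theta/2$ is equivalent to the three circles lying inside the triangle. *)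

theory Defs
  imports "HOL-Complex_Analysis.Complex_Analysis"
begin

text \<open>The plane is \<^typ>\<open>complex\<close>, and angles and arc measures are in radians.\<close>

definition vertex_angle :: "complex \<Rightarrow> complex \<Rightarrow> complex \<Rightarrow> real" where
  "vertex_angle B A C = arccos (((B - A) \<bullet> (C - A)) / (norm (B - A) * norm (C - A)))"

definition same_side :: "complex \<Rightarrow> complex \<Rightarrow> complex \<Rightarrow> complex \<Rightarrow> bool" where
  "same_side B C P Q \<longleftrightarrow> closed_segment P Q \<inter> affine hull {B, C} = {}"

text \<open>The circle is tangent to the line \<open>XY\<close>, and the point of tangency \<open>P\<close> is on the side \<open>XY\<close>.\<close>

definition touches_side_at :: "complex \<Rightarrow> real \<Rightarrow> complex \<Rightarrow> complex \<Rightarrow> complex \<Rightarrow> bool" where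
  "touches_side_at c r X Y P \<longleftrightarrow>
     sphere c r \<inter> affine hull {X, Y} = {P} \<and> P \<in> closed_segment X Y"

definition is_incenter :: "complex \<Rightarrow> complex \<Rightarrow> complex \<Rightarrow> complex \<Rightarrow> bool" where
  "is_incenter A B C I \<longleftrightarrow>
     (\<exists>r>0. cball I r \<subseteq> convex hull {A, B, C} \<and>
        (\<exists>P. touches_side_at I r B C P) \<and>
        (\<exists>P. touches_side_at I r C A P) \<and>
        (\<exists>P. touches_side_at I r A B P))"

text \<open>
  \<open>W\<close> is the arc of angular measure \<open>\<theta>\<close> on the circle with center \<open>z\<close> and radius \<open>R\<close>,
  with endpoints \<open>B\<close> and \<open>C\<close>, on the same side of the line \<open>BC\<close> as \<open>A\<close>.  As the arc is
  traversed counterclockwise, which of \<open>B\<close> and \<open>C\<close> comes first depends on the orientation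
  of the triangle.
\<close>

definition internal_arc ::
    "real \<Rightarrow> complex \<Rightarrow> complex \<Rightarrow> complex \<Rightarrow> complex \<Rightarrow> real \<Rightarrow> complex set \<Rightarrow> bool" where
  "internal_arc \<theta> A B C z R W \<longleftrightarrow>
     R > 0 \<and>
     (\<exists>s. let g = part_circlepath z R s (s + \<theta>) in
        W = path_image g \<and> {pathstart g, pathfinish g} = {B, C}) \<and>
     (\<forall>P \<in> W - {B, C}. same_side B C P A)"

definition externally_tangent_at :: "complex \<Rightarrow> real \<Rightarrow> complex \<Rightarrow> real \<Rightarrow> complex \<Rightarrow> bool" where
  "externally_tangent_at c r z R T \<longleftrightarrow>
     sphere c r \<inter> sphere z R = {T} \<and> ball c r \<inter> ball z R = {}"

text \<open>
  The circle of the general triad belonging to the first vertex \<open>A\<close>; the other two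
  are obtained by permuting the vertices.
\<close>

definition triad_circle ::
    "real \<Rightarrow> complex \<Rightarrow> complex \<Rightarrow> complex \<Rightarrow> complex \<Rightarrow> real \<Rightarrow> bool" where
  "triad_circle \<theta> A B C c r \<longleftrightarrow>
     r > 0 \<and> cball c r \<subseteq> convex hull {A, B, C} \<and>
     (\<exists>P. touches_side_at c r A B P) \<and>
     (\<exists>P. touches_side_at c r A C P) \<and>
     (\<exists>z R W. internal_arc \<theta> A B C z R W \<and> (\<exists>T\<in>W. externally_tangent_at c r z R T))"

end

theory Submission
  imports Defs
begin

text \<open>
  Let \<open>D, E, F\<close> be the points where the incircle, of radius \<open>r\<close>, touches \<open>BC, CA, AB\<close>, and
  let \<open>\<rho>\<close> be the radius of \<open>\<gamma>\<^sub>a\<close>.  Both circles are inscribed in the angle at \<open>A\<close>, so a homothety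
  with center \<open>A\<close> and ratio \<open>\<rho> / r = 1 - k\<close> carries the incircle to \<open>\<gamma>\<^sub>a\<close> and \<open>F\<close> to the point \<open>P\<close>
  where \<open>\<gamma>\<^sub>a\<close> touches \<open>AB\<close> (lemma \<open>inscribed_in_angle_homothetic\<close>).  Hence \<open>P\<close> is at distance
  \<open>k \<cdot> AF\<close> from \<open>F\<close>, and, as \<open>IF\<close> is perpendicular to \<open>AB\<close>, the distance \<open>IP\<close> is determined by
  \<open>r\<close> and \<open>k \<cdot> AF\<close>.  It is enough to see that \<open>k \<cdot> AF\<close> does not depend on the vertex; in fact
  \<open>k \<cdot> AF = r tan (\<theta> / 4)\<close>, so that all six points are at distance
  \<open>r sqrt (1 + tan\<^sup>2 (\<theta> / 4))\<close> from \<open>I\<close> (lemma \<open>triad_touch_point_dist\<close>).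

  The condition that \<open>\<gamma>\<^sub>a\<close> is externally tangent to the circle of \<open>\<omega>\<^sub>a\<close>, with center \<open>z\<close> and radius \<open>R\<close>, is
  that the centers are at distance \<open>R + \<rho>\<close>.  In rectangular coordinates with origin \<open>D\<close> and first
  axis along \<open>BC\<close>, it is a quadratic equation for \<open>k\<close>.  Expressed in the tangent lengths \<open>x, y, w\<close>
  from \<open>A, B, C\<close> to the incircle, with \<open>t = tan (\<theta> / 4)\<close>, it has the two roots \<open>t r / x\<close> and
  \<open>- (y w + (y + w) t r) / (x t r)\<close> (lemma \<open>tangency_factorization\<close>).  The second one is negative
  and gives the circle on the far side of \<open>\<omega>\<^sub>a\<close>, which is larger than the incircle; a circle inside
  the triangle is not, so \<open>k\<close> is the first root.
\<close>

section \<open>Lines and half-planes\<close>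

text \<open>
  A unit vector orthogonal to a side and pointing to the third vertex replaces a choice of
  orientation for the triangle: signed distances from the side \<open>XY\<close> are \<open>n \<bullet> (p - X)\<close>.
\<close>

definition inward_normal :: "complex \<Rightarrow> complex \<Rightarrow> complex \<Rightarrow> complex \<Rightarrow> bool" where
  "inward_normal X Y Z n \<longleftrightarrow> norm n = 1 \<and> n \<bullet> (Y - X) = 0 \<and> n \<bullet> (Z - X) > 0"

lemma orthogonal_in_plane_parallel:
  fixes d n v :: complex
  assumes "d \<noteq> 0" "norm n = 1" "n \<bullet> d = 0" "v \<bullet> d = 0"
  shows "v = (v \<bullet> n) *\<^sub>R n"
proof -
  obtain a b where d: "d = Complex a b" by (cases d)
  obtain p q where n: "n = Complex p q" by (cases n)
  obtain x y where v: "v = Complex x y" by (cases v)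
  have 1: "p\<^sup>2 + q\<^sup>2 = 1" using assms(2) unfolding n cmod_def by simp
  have 2: "p * a + q * b = 0" "x * a + y * b = 0"
    using assms(3,4) by (simp_all add: n d v inner_complex_def)
  have "a * (x * q - y * p) = 0" "b * (x * q - y * p) = 0" using 2 by algebra+
  moreover have "a \<noteq> 0 \<or> b \<noteq> 0" using assms(1) d complex_eq_iff by auto
  ultimately have 3: "x * q = y * p" by auto
  have "x = (x * p + y * q) * p" "y = (x * p + y * q) * q" using 1 3 by algebra+
  then show ?thesis by (simp add: v n inner_complex_def complex_eq_iff)
qed

lemma noncollinear_imp_distinct:
  fixes X Y Z :: complex
  assumes "\<not> collinear {X, Y, Z}"
  shows "X \<noteq> Y" "Y \<noteq> Z" "X \<noteq> Z"
  using assms by (auto simp: insert_commute)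

lemma mem_line_iff_normal:
  fixes n p X Y :: complex
  assumes n: "norm n = 1" "n \<bullet> (Y - X) = 0" and "X \<noteq> Y"
  shows "p \<in> affine hull {X, Y} \<longleftrightarrow> n \<bullet> (p - X) = 0"
proof
  assume "p \<in> affine hull {X, Y}"
  then obtain u where "p = X + u *\<^sub>R (Y - X)" by (auto simp: affine_hull_2_alt)
  then show "n \<bullet> (p - X) = 0" using n(2) by simp
next
  assume 0: "n \<bullet> (p - X) = 0"
  define d where "d = (1 / norm (Y - X)) *\<^sub>R (Y - X)"
  have nd: "norm d = 1" using assms(3) by (simp add: d_def)
  have "p - X = ((p - X) \<bullet> d) *\<^sub>R d"
    using n 0 nd
    by (intro orthogonal_in_plane_parallel[of n]) (auto simp: d_def inner_commute)
  also have "\<dots> = (((p - X) \<bullet> d) / norm (Y - X)) *\<^sub>R (Y - X)" by (simp add: d_def)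
  finally have "p = X + (((p - X) \<bullet> d) / norm (Y - X)) *\<^sub>R (Y - X)"
    by (metis add.commute diff_add_cancel)
  then show "p \<in> affine hull {X, Y}" using affine_hull_2_alt[of X Y] by blast
qed

text \<open>
  Turning the direction of \<open>XY\<close> by a right angle gives one of the two unit normals; the sign is
  then chosen by the side on which \<open>Z\<close> lies.
\<close>

lemma exists_inward_normal:
  assumes "\<not> collinear {X, Y, Z}"
  shows "\<exists>n. inward_normal X Y Z n"
proof -
  note ne = noncollinear_imp_distinct[OF assms]
  define d where "d = Y - X"
  define m where "m = \<i> * d / norm d"
  have d0: "d \<noteq> 0" using ne by (simp add: d_def)
  have m1: "norm m = 1" using d0 by (simp add: m_def norm_mult norm_divide)
  have m2: "m \<bullet> d = 0" by (simp add: m_def inner_complex_def)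
  have "Z \<notin> affine hull {X, Y}"
    using assms ne collinear_3_affine_hull[of X Y Z] by auto
  then have m3: "m \<bullet> (Z - X) \<noteq> 0"
    using mem_line_iff_normal[of m Y X Z] m1 m2 ne by (simp add: d_def)
  show ?thesis
  proof (cases "m \<bullet> (Z - X) > 0")
    case True
    then show ?thesis using m1 m2 by (auto simp: inward_normal_def d_def)
  next
    case False
    then have "inward_normal X Y Z (- m)"
      using m1 m2 m3 by (simp add: inward_normal_def d_def)
    then show ?thesis ..
  qed
qed

lemma triangle_in_halfplane:
  assumes "inward_normal X Y Z n" "p \<in> convex hull {X, Y, Z}"
  shows "n \<bullet> (p - X) \<ge> 0"
proof -
  have "convex hull {X, Y, Z} \<subseteq> {p. n \<bullet> p \<ge> n \<bullet> X}"
    using assms(1)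
    by (intro hull_minimal) (auto simp: inward_normal_def inner_diff_right convex_halfspace_ge)
  then show ?thesis using assms(2) by (auto simp: inner_diff_right)
qed

section \<open>Tangency\<close>

text \<open>
  If the radius at \<open>P\<close> were oblique to the line, the reflection of \<open>P\<close> in the foot of the
  perpendicular from \<open>c\<close> would be a second common point of line and circle.
\<close>

lemma tangent_radius_orthogonal:
  assumes "touches_side_at c r X Y P"
  shows "(c - P) \<bullet> (Y - X) = 0" "norm (c - P) = r"
proof -
  have P: "sphere c r \<inter> affine hull {X, Y} = {P}"
    using assms by (simp add: touches_side_at_def)
  then have Pin: "P \<in> sphere c r" "P \<in> affine hull {X, Y}" by auto
  from Pin(1) show r: "norm (c - P) = r" by (simp add: dist_norm)
  show "(c - P) \<bullet> (Y - X) = 0"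
  proof (cases "Y = X")
    case False
    \<comment> \<open>The reflected point is \<open>P + l (Y - X)\<close>.\<close>
    define l where "l = 2 * ((c - P) \<bullet> (Y - X)) / ((Y - X) \<bullet> (Y - X))"
    have l: "l * ((Y - X) \<bullet> (Y - X)) = 2 * ((c - P) \<bullet> (Y - X))"
      using False by (simp add: l_def)
    obtain u where u: "P = X + u *\<^sub>R (Y - X)" using Pin(2) by (auto simp: affine_hull_2_alt)
    have "P + l *\<^sub>R (Y - X) = X + (u + l) *\<^sub>R (Y - X)" using u by (simp add: algebra_simps)
    then have 1: "P + l *\<^sub>R (Y - X) \<in> affine hull {X, Y}"
      using affine_hull_2_alt[of X Y] by blast
    have "(norm ((c - P) - l *\<^sub>R (Y - X)))\<^sup>2
        = (norm (c - P))\<^sup>2 - 2 * l * ((c - P) \<bullet> (Y - X)) + l * (l * ((Y - X) \<bullet> (Y - X)))"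
      unfolding power2_norm_eq_inner by (simp add: inner_diff_left inner_diff_right inner_commute algebra_simps)
    also have "\<dots> = (norm (c - P))\<^sup>2" unfolding l by simp
    finally have "norm ((c - P) - l *\<^sub>R (Y - X)) = r"
      using r by (metis norm_ge_zero power2_eq_iff_nonneg)
    then have "P + l *\<^sub>R (Y - X) \<in> sphere c r" by (simp add: dist_norm algebra_simps)
    with 1 P have "P + l *\<^sub>R (Y - X) = P" by blast
    then have "l = 0" using False by simp
    then show ?thesis using l by simp
  qed simp
qed

text \<open>
  The radius at \<open>P\<close> is parallel to the normal, and the center, being in the triangle, lies on
  the inner side of the line.
\<close>

lemma inscribed_center_offset:
  assumes n: "inward_normal X Y Z n" and "X \<noteq> Y" "r > 0"
    and sub: "cball c r \<subseteq> convex hull {X, Y, Z}"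
    and t: "touches_side_at c r X Y P"
  shows "c = P + r *\<^sub>R n"
proof -
  note o = tangent_radius_orthogonal[OF t]
  have nn: "norm n = 1" "n \<bullet> (Y - X) = 0" using n by (auto simp: inward_normal_def)
  have eq: "c - P = ((c - P) \<bullet> n) *\<^sub>R n"
    using assms(2) nn o by (intro orthogonal_in_plane_parallel[of "Y - X"]) auto
  have "P \<in> affine hull {X, Y}" using t by (auto simp: touches_side_at_def)
  then have "n \<bullet> (P - X) = 0" using mem_line_iff_normal[OF nn assms(2)] by simp
  moreover have "c \<in> convex hull {X, Y, Z}" using sub \<open>r > 0\<close> by auto
  then have "n \<bullet> (c - X) \<ge> 0" by (rule triangle_in_halfplane[OF n])
  ultimately have "(c - P) \<bullet> n \<ge> 0" by (simp add: inner_diff_right inner_diff_left inner_commute)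
  moreover have "\<bar>(c - P) \<bullet> n\<bar> = r" using eq o(2) nn by (metis norm_scaleR mult.right_neutral)
  ultimately have "(c - P) \<bullet> n = r" by simp
  then show ?thesis using eq by (simp add: algebra_simps)
qed

text \<open>
  The common point gives \<open>dist c z \<le> R + r\<close>; if the inequality were strict, the point dividing
  the segment from \<open>c\<close> to \<open>z\<close> in the ratio \<open>r : R\<close> would lie in both open discs.
\<close>

lemma externally_tangent_dist:
  assumes "externally_tangent_at c r z R T" "r > 0" "R > 0"
  shows "dist c z = R + r"
proof -
  have "T \<in> sphere c r" "T \<in> sphere z R" using assms(1) by (auto simp: externally_tangent_at_def)
  then have "dist c z \<le> R + r" using dist_triangle[of c z T] by (simp add: dist_commute)
  moreover have "\<not> dist c z < R + r"
  proof
    assume l: "dist c z < R + r"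
    define q where "q = c + (r / (R + r)) *\<^sub>R (z - c)"
    have "dist c q = r / (R + r) * dist c z"
      using assms by (simp add: q_def dist_norm norm_minus_commute)
    also have "\<dots> < r" using mult_strict_left_mono[OF l \<open>r > 0\<close>] assms by (simp add: divide_less_eq)
    finally have 1: "q \<in> ball c r" by simp
    have "z - q = (1 - r / (R + r)) *\<^sub>R (z - c)" by (simp add: q_def algebra_simps)
    also have "1 - r / (R + r) = R / (R + r)" using assms by (simp add: field_simps)
    finally have "dist z q = R / (R + r) * dist c z"
      using assms by (simp add: dist_norm norm_minus_commute)
    also have "\<dots> < R" using mult_strict_left_mono[OF l \<open>R > 0\<close>] assms by (simp add: divide_less_eq)
    finally have "q \<in> ball z R" by simp
    with 1 assms(1) show False by (auto simp: externally_tangent_at_def)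
  qed
  ultimately show ?thesis by simp
qed

section \<open>The circle that carries the arc\<close>

text \<open>
  The radius through the midpoint \<open>N\<close> of the arc is perpendicular to the chord \<open>BC\<close>, hence
  parallel to \<open>n\<close>, and the condition on the side of the arc, applied to \<open>N\<close>, makes it point
  in the direction of \<open>n\<close>.  The signed factor \<open>R * cos (\<theta> / 2)\<close> covers both minor and major arcs.
\<close>

lemma internal_arc_center:
  assumes arc: "internal_arc \<theta> A B C z R W" and n: "inward_normal B C A n" and "B \<noteq> C"
    and th: "0 < \<theta>" "\<theta> < 2 * pi"
  shows "z = midpoint B C - (R * cos (\<theta> / 2)) *\<^sub>R n" "norm (C - B) = 2 * R * sin (\<theta> / 2)"
proof -
  obtain s where R: "R > 0"
    and W: "W = path_image (part_circlepath z R s (s + \<theta>))"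
    and ends: "{pathstart (part_circlepath z R s (s + \<theta>)), pathfinish (part_circlepath z R s (s + \<theta>))} = {B, C}"
    and side: "\<forall>P \<in> W - {B, C}. same_side B C P A"
    using arc by (auto simp: internal_arc_def Let_def)
  define v where "v = cis (s + \<theta> / 2)"
  define N where "N = z + R *\<^sub>R v"
  have nv: "norm v = 1" by (simp add: v_def)
  have nn: "norm n = 1" "n \<bullet> (C - B) = 0" "n \<bullet> (A - B) > 0"
    using n by (auto simp: inward_normal_def)
  have co: "cos (\<theta> / 2) < 1" using cos_monotone_0_pi[of 0 "\<theta> / 2"] th by simp
  have si: "sin (\<theta> / 2) > 0" using th by (intro sin_gt_zero) auto
  define S where "S = z + R *\<^sub>R (v * cis (- (\<theta> / 2)))"
  define T where "T = z + R *\<^sub>R (v * cis (\<theta> / 2))"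
  have "v * cis (- (\<theta> / 2)) = cis s" "v * cis (\<theta> / 2) = cis (s + \<theta>)"
    by (simp_all add: v_def cis_mult add.commute)
  then have ST: "{S, T} = {B, C}"
    using ends by (simp add: S_def T_def cis_conv_exp scaleR_conv_of_real)
  have "B + C = S + T" "(C - B = T - S \<or> C - B = S - T)"
    using ST by (auto simp: doubleton_eq_iff)
  then have M: "midpoint B C = z + (R * cos (\<theta> / 2)) *\<^sub>R v"
    and CB: "C - B = (2 * R * sin (\<theta> / 2)) *\<^sub>R (\<i> * v) \<or> C - B = - (2 * R * sin (\<theta> / 2)) *\<^sub>R (\<i> * v)"
    by (auto simp: S_def T_def midpoint_def complex_eq_iff algebra_simps)
  show len: "norm (C - B) = 2 * R * sin (\<theta> / 2)"
    using CB R si nv by (auto simp: norm_mult)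
  have "v \<bullet> (\<i> * v) = 0" by (simp add: inner_complex_def)
  then have "v \<bullet> (C - B) = 0" using CB by fastforce
  then have par: "v = (v \<bullet> n) *\<^sub>R n"
    using nn assms(3) by (intro orthogonal_in_plane_parallel[of "C - B"]) auto
  then have absv: "\<bar>v \<bullet> n\<bar> = 1" using nv nn by (metis norm_scaleR mult.right_neutral)
  have "n \<bullet> (midpoint B C - B) = 0"
    using nn(2) by (simp add: midpoint_def inner_diff_right inner_add_right)
  moreover have NM: "N = midpoint B C + (R * (1 - cos (\<theta> / 2))) *\<^sub>R v"
    by (simp add: N_def M algebra_simps)
  ultimately have hN: "n \<bullet> (N - B) = R * (1 - cos (\<theta> / 2)) * (v \<bullet> n)"
    by (simp add: inner_diff_right inner_add_right inner_commute)
  have "N \<in> W"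
    unfolding W N_def v_def path_image_part_circlepath' using th
    by (auto simp: scaleR_conv_of_real closed_segment_eq_real_ivl intro!: imageI)
  moreover have "N \<notin> {B, C}" using hN absv co R nn(2) by (auto simp: inner_diff_right)
  ultimately have ss: "closed_segment N A \<inter> affine hull {B, C} = {}"
    using side by (auto simp: same_side_def)
  have "v \<bullet> n > 0"
  proof (rule ccontr)
    assume "\<not> v \<bullet> n > 0"
    then have "v \<bullet> n = - 1" using absv by auto
    then have neg: "n \<bullet> (N - B) < 0" using hN co R by simp
    \<comment> \<open>The segment from \<open>N\<close> to \<open>A\<close> would cross the line \<open>BC\<close> at the parameter \<open>l\<close>.\<close>
    define l where "l = - (n \<bullet> (N - B)) / (n \<bullet> (A - B) - n \<bullet> (N - B))"
    have l: "0 \<le> l" "l \<le> 1" "l * (n \<bullet> (A - B) - n \<bullet> (N - B)) = - (n \<bullet> (N - B))"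
      using neg nn(3) by (auto simp: l_def field_simps)
    define q where "q = (1 - l) *\<^sub>R N + l *\<^sub>R A"
    have "n \<bullet> (q - B) = n \<bullet> (N - B) + l * (n \<bullet> (A - B) - n \<bullet> (N - B))"
      by (simp add: q_def inner_diff_right inner_add_right algebra_simps)
    then have "n \<bullet> (q - B) = 0" using l(3) by simp
    then have "q \<in> affine hull {B, C}" using mem_line_iff_normal[OF nn(1,2) assms(3)] by simp
    moreover have "q \<in> closed_segment N A" using l by (auto simp: q_def in_segment)
    ultimately show False using ss by blast
  qed
  then have "v = n" using par absv by simp
  then show "z = midpoint B C - (R * cos (\<theta> / 2)) *\<^sub>R n" using M by simp
qed

text \<open>
  Here \<open>2 * R * sin (\<theta> / 2)\<close> is the length of the chord and \<open>R * cos (\<theta> / 2)\<close> the signed distance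
  of its midpoint from the center.  Their ratios to \<open>R\<close> are rational in \<open>tan (\<theta> / 4)\<close>, which
  turns the tangency condition into a polynomial equation.
\<close>

lemma tan_quarter_arc:
  assumes "0 < \<theta>" "\<theta> < 2 * pi"
  shows "tan (\<theta> / 4) > 0"
    and "4 * tan (\<theta> / 4) * R = 2 * R * sin (\<theta> / 2) * (1 + (tan (\<theta> / 4))\<^sup>2)"
    and "4 * tan (\<theta> / 4) * (R * cos (\<theta> / 2)) = 2 * R * sin (\<theta> / 2) * (1 - (tan (\<theta> / 4))\<^sup>2)"
proof -
  define s c where "s = sin (\<theta> / 4)" and "c = cos (\<theta> / 4)"
  have c: "c > 0" using assms by (auto simp: c_def intro!: cos_gt_zero)
  have one: "s\<^sup>2 + c\<^sup>2 = 1" by (simp add: s_def c_def)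
  show "tan (\<theta> / 4) > 0" using assms by (intro tan_gt_zero) auto
  define q where "q = s / c"
  have t: "tan (\<theta> / 4) = q" by (simp add: tan_def s_def c_def q_def)
  have d: "sin (\<theta> / 2) = 2 * s * c" "cos (\<theta> / 2) = c\<^sup>2 - s\<^sup>2"
    using sin_double[of "\<theta> / 4"] cos_double[of "\<theta> / 4"] by (simp_all add: s_def c_def)
  have s: "s = q * c" using c by (simp add: q_def)
  show "4 * tan (\<theta> / 4) * R = 2 * R * sin (\<theta> / 2) * (1 + (tan (\<theta> / 4))\<^sup>2)"
    "4 * tan (\<theta> / 4) * (R * cos (\<theta> / 2)) = 2 * R * sin (\<theta> / 2) * (1 - (tan (\<theta> / 4))\<^sup>2)"
    unfolding t d using s one by algebra+
qed

section \<open>The tangency condition in coordinates\<close>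

text \<open>
  With the touch point \<open>D\<close> of the incircle on \<open>BC\<close> as origin and \<open>BC\<close> as first axis, \<open>B, C, I, A\<close>
  are \<open>(-y, 0)\<close>, \<open>(w, 0)\<close>, \<open>(0, r)\<close>, \<open>(p, h)\<close>.  The assumptions say that \<open>AB = x + y\<close>,
  \<open>AC = x + w\<close> and \<open>AI\<^sup>2 = x\<^sup>2 + r\<^sup>2\<close>, where \<open>x, y, w\<close> are the tangent lengths from \<open>A, B, C\<close>.
  The third conclusion is a form of Heron's formula.
\<close>

lemma incircle_foot_coordinates:
  fixes x y w r p h :: real
  assumes "(x + y)\<^sup>2 = (p + y)\<^sup>2 + h\<^sup>2" "(x + w)\<^sup>2 = (p - w)\<^sup>2 + h\<^sup>2" "x\<^sup>2 + r\<^sup>2 = p\<^sup>2 + (h - r)\<^sup>2"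
    and "r > 0" "h > 0" "y + w > 0" "x \<ge> 0" "y \<ge> 0" "w \<ge> 0"
  shows "p * (y + w) = x * (y - w)" "h * (y + w) = 2 * r * (x + y + w)"
    "r\<^sup>2 * (x + y + w) = x * y * w" "x > 0" "y > 0" "w > 0"
proof -
  have 1: "x * y = p * y + h * r" "x * w = h * r - p * w"
    using assms(1-3) by (simp_all add: power2_eq_square algebra_simps)
  have 2: "2 * (x * y * w) = h * r * (y + w)" using 1 by algebra
  then have "x * y * w > 0" using assms by (smt (verit) mult_pos_pos)
  then show pos: "x > 0" "y > 0" "w > 0" using assms(7-9) by (auto simp: less_le)
  show 3: "p * (y + w) = x * (y - w)" using 1 by algebra
  have 4: "x\<^sup>2 = p\<^sup>2 + h * (h - 2 * r)" using assms(3) by (simp add: power2_eq_square algebra_simps)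
  have "x\<^sup>2 * (y + w)\<^sup>2 = x\<^sup>2 * (y - w)\<^sup>2 + h * (h - 2 * r) * (y + w)\<^sup>2" using 3 4 by algebra
  then have "4 * x * (x * y * w) = h * (h - 2 * r) * (y + w)\<^sup>2" by algebra
  then have "(h * (y + w)) * (2 * x * r) = (h * (y + w)) * ((h - 2 * r) * (y + w))" using 2 by algebra
  then have 5: "2 * x * r = (h - 2 * r) * (y + w)" using assms(5,6) by simp
  then show "h * (y + w) = 2 * r * (x + y + w)" by (simp add: algebra_simps)
  with 2 show "r\<^sup>2 * (x + y + w) = x * y * w" by algebra
qed

text \<open>
  In the same coordinates the arc has center \<open>((w - y) / 2, -g)\<close>, and the circle at \<open>A\<close> has
  center \<open>(k p, k h + (1 - k) r)\<close> and radius \<open>(1 - k) r\<close>; the last assumption is external tangency.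
  The leading coefficient in \<open>k\<close> is \<open>p\<^sup>2 + (h - r)\<^sup>2 - r\<^sup>2 = x\<^sup>2\<close> and the constant term is
  \<open>- (w y + (y + w) t r)\<close>, so for \<open>k \<ge> 0\<close> only the positive root \<open>t r / x\<close> is possible.
\<close>

lemma tangency_factorization:
  fixes x y w r p h k t R g :: real
  assumes "p * (y + w) = x * (y - w)" "h * (y + w) = 2 * r * (x + y + w)"
    "r\<^sup>2 * (x + y + w) = x * y * w"
    and pos: "x > 0" "y > 0" "w > 0" "r > 0" "t > 0" "k \<ge> 0"
    and R: "4 * t * R = (y + w) * (1 + t\<^sup>2)" "4 * t * g = (y + w) * (1 - t\<^sup>2)"
    and xr: "x\<^sup>2 + r\<^sup>2 = p\<^sup>2 + (h - r)\<^sup>2"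
    and eq: "(k * p - (w - y) / 2)\<^sup>2 + (k * h + (1 - k) * r + g)\<^sup>2 = (R + (1 - k) * r)\<^sup>2"
  shows "x * k = t * r"
proof -
  define a where "a = y + w"
  have a: "a > 0" using pos by (simp add: a_def)
  have gR: "R - g = a * t / 2" "R + g = a / (2 * t)"
  proof -
    have "4 * t * (R - g) = 4 * t * (a * t / 2)" "a = 2 * t * (R + g)"
      using R by (simp_all add: a_def power2_eq_square algebra_simps)
    then show "R - g = a * t / 2" "R + g = a / (2 * t)" using \<open>t > 0\<close> by simp_all
  qed
  \<comment> \<open>These two identities put the coefficient of \<open>k\<close> into terms of \<open>x, a, r, t\<close>.\<close>
  have cross: "2 * h * r - p * (w - y) = x * a"
  proof -
    have "a * (2 * h * r - p * (w - y)) = a * (x * a)"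
      using assms(1-3) unfolding a_def by algebra
    then show ?thesis using a by simp
  qed
  have hg: "2 * h * g * t = r * (x + a) * (1 - t\<^sup>2)"
    using assms(2) R(2) a unfolding a_def by algebra
  have const: "(w - y)\<^sup>2 / 4 + g\<^sup>2 - R\<^sup>2 = - (w * y)"
  proof -
    have "R\<^sup>2 - g\<^sup>2 = (R - g) * (R + g)" by algebra
    also have "\<dots> = a\<^sup>2 / 4" unfolding gR using pos by (simp add: power2_eq_square)
    finally show ?thesis by (simp add: a_def power2_eq_square field_simps)
  qed
  have "k\<^sup>2 * x\<^sup>2 + k * (x * a + 2 * h * g + r * (a * t)) - w * y - r * (a * t) = 0"
  proof -
    have at: "a * t = 2 * (R - g)" using gR by simp
    have "k\<^sup>2 * x\<^sup>2 + k * (x * a + 2 * h * g + r * (2 * (R - g))) - w * y - r * (2 * (R - g))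
        = ((k * p - (w - y) / 2)\<^sup>2 + (k * h + (1 - k) * r + g)\<^sup>2 - (R + (1 - k) * r)\<^sup>2)
          + k\<^sup>2 * (x\<^sup>2 + r\<^sup>2 - (p\<^sup>2 + (h - r)\<^sup>2)) + k * (x * a - (2 * h * r - p * (w - y)))
          - ((w - y)\<^sup>2 / 4 + g\<^sup>2 - R\<^sup>2 + w * y)"
      by (simp add: power2_eq_square field_simps)
    then show ?thesis unfolding at eq xr cross const by simp
  qed
  then have "t * r * (k\<^sup>2 * x\<^sup>2 + k * (x * a + 2 * h * g + r * (a * t)) - w * y - r * (a * t)) = 0" by simp
  then have "(x * k - t * r) * (x * k * (t * r) + (w * y + a * t * r)) = 0"
    using hg assms(3) unfolding a_def by algebra
  moreover have "x * k * (t * r) + (w * y + a * t * r) > 0"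
    using pos a by (intro add_nonneg_pos add_pos_pos mult_pos_pos mult_nonneg_nonneg) auto
  ultimately show ?thesis by auto
qed


section \<open>Circles inscribed in an angle of the triangle\<close>

lemma tangent_length:
  assumes "touches_side_at c r X Y P"
  shows "(dist X c)\<^sup>2 = (dist X P)\<^sup>2 + r\<^sup>2" "(dist Y c)\<^sup>2 = (dist Y P)\<^sup>2 + r\<^sup>2"
    "dist X Y = dist X P + dist Y P"
proof -
  note o = tangent_radius_orthogonal[OF assms]
  have "P \<in> closed_segment X Y" using assms by (simp add: touches_side_at_def)
  then obtain u where u: "P = X + u *\<^sub>R (Y - X)" by (auto simp: in_segment algebra_simps)
  have "orthogonal (P - X) (c - P)" "orthogonal (P - Y) (c - P)"
  proof -
    have "P - X = u *\<^sub>R (Y - X)" "P - Y = (u - 1) *\<^sub>R (Y - X)" using u by (simp_all add: algebra_simps)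
    then show "orthogonal (P - X) (c - P)" "orthogonal (P - Y) (c - P)"
      using o(1) by (simp_all add: orthogonal_def inner_commute)
  qed
  from this[THEN norm_add_Pythagorean]
  show "(dist X c)\<^sup>2 = (dist X P)\<^sup>2 + r\<^sup>2" "(dist Y c)\<^sup>2 = (dist Y P)\<^sup>2 + r\<^sup>2"
    using o(2) by (simp_all add: dist_norm norm_minus_commute)
  show "dist X Y = dist X P + dist Y P"
    using \<open>P \<in> closed_segment X Y\<close> by (metis between between_mem_segment dist_commute)
qed

text \<open>
  Let \<open>u\<close> be the difference of \<open>c\<close> and the image of \<open>I\<close> under the homothety at \<open>A\<close> with ratio
  \<open>\<rho> / r\<close>.  The homothety also scales the radius \<open>r\<close> to \<open>\<rho>\<close>, so both of these points are at
  distance \<open>\<rho>\<close> inward from \<open>AB\<close> and from \<open>AC\<close>; thus \<open>u\<close> is parallel to both sides and vanishes.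
\<close>

lemma inscribed_in_angle_homothetic:
  assumes tri: "\<not> collinear {A, B, C}" and pos: "r > 0" "\<rho> > 0"
    and I: "cball I r \<subseteq> convex hull {A, B, C}" "touches_side_at I r A B F" "touches_side_at I r A C E"
    and c: "cball c \<rho> \<subseteq> convex hull {A, B, C}" "touches_side_at c \<rho> A B P" "touches_side_at c \<rho> A C Q"
  shows "c - A = (\<rho> / r) *\<^sub>R (I - A)" "P - A = (\<rho> / r) *\<^sub>R (F - A)"
proof -
  note ne = noncollinear_imp_distinct[OF tri]
  have hull: "convex hull {A, C, B} = convex hull {A, B, C}" by (simp add: insert_commute)
  obtain m where m: "inward_normal A B C m" using exists_inward_normal[OF tri] by blast
  obtain n where n: "inward_normal A C B n"
    using exists_inward_normal[of A C B] tri by (auto simp: insert_commute)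
  have off: "I = F + r *\<^sub>R m" "c = P + \<rho> *\<^sub>R m" "I = E + r *\<^sub>R n" "c = Q + \<rho> *\<^sub>R n"
    using inscribed_center_offset[OF m ne(1) pos(1) I(1,2)]
      inscribed_center_offset[OF m ne(1) pos(2) c(1,2)]
      inscribed_center_offset[OF n ne(3) pos(1)] inscribed_center_offset[OF n ne(3) pos(2)]
      I(1,3) c(1,3) hull by auto
  have mm: "norm m = 1" "m \<bullet> (B - A) = 0" using m by (auto simp: inward_normal_def)
  have nn: "norm n = 1" "n \<bullet> (C - A) = 0" "n \<bullet> (B - A) > 0" using n by (auto simp: inward_normal_def)
  have "F \<in> affine hull {A, B}" "P \<in> affine hull {A, B}" "E \<in> affine hull {A, C}" "Q \<in> affine hull {A, C}"
    using I c by (auto simp: touches_side_at_def)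
  then have on: "m \<bullet> (F - A) = 0" "m \<bullet> (P - A) = 0" "n \<bullet> (E - A) = 0" "n \<bullet> (Q - A) = 0"
    using mem_line_iff_normal[OF mm ne(1)] mem_line_iff_normal[OF nn(1,2) ne(3)] by auto
  define u where "u = (c - A) - (\<rho> / r) *\<^sub>R (I - A)"
  have u1: "u = (P - A) - (\<rho> / r) *\<^sub>R (F - A)" unfolding u_def off(1,2)
    using pos by (simp add: algebra_simps)
  have u2: "u = (Q - A) - (\<rho> / r) *\<^sub>R (E - A)" unfolding u_def off(3,4)
    using pos by (simp add: algebra_simps)
  have mu: "m \<bullet> u = 0" unfolding u1 by (simp add: inner_diff_right[of m "P - A"] on)
  have nu: "n \<bullet> u = 0" unfolding u2 by (simp add: inner_diff_right[of n "Q - A"] on)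
  from mu have "A + u \<in> affine hull {A, B}" using mem_line_iff_normal[OF mm ne(1)] by simp
  then obtain l where "A + u = A + l *\<^sub>R (B - A)" unfolding affine_hull_2_alt by blast
  then have "u = l *\<^sub>R (B - A)" by (metis add_left_cancel)
  with nu nn(3) have "u = 0" by simp
  then show "c - A = (\<rho> / r) *\<^sub>R (I - A)" "P - A = (\<rho> / r) *\<^sub>R (F - A)"
    using u_def u1 by simp_all
qed

section \<open>The common distance from the incenter\<close>

text \<open>
  The value depends only on the incircle and on \<open>\<theta>\<close>, not on the vertex \<open>A\<close>; this is why the
  six points are concyclic.
\<close>

lemma triad_touch_point_dist:
  assumes tri: "\<not> collinear {A, B, C}" and th: "0 < \<theta>" "\<theta> < 2 * pi" and "r > 0"
    and I: "cball I r \<subseteq> convex hull {A, B, C}" "touches_side_at I r B C D"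
      "touches_side_at I r A C E" "touches_side_at I r A B F"
    and triad: "triad_circle \<theta> A B C c \<rho>" and touch: "touches_side_at c \<rho> A B P"
  shows "dist I P = r * sqrt (1 + (tan (\<theta> / 4))\<^sup>2)"
proof -
  note ne = noncollinear_imp_distinct[OF tri]
  have rot: "{B, C, A} = {A, B, C}" by auto
  obtain Q z R W T where rho: "\<rho> > 0" and cin: "cball c \<rho> \<subseteq> convex hull {A, B, C}"
    and Q: "touches_side_at c \<rho> A C Q" and arc: "internal_arc \<theta> A B C z R W"
    and tang: "externally_tangent_at c \<rho> z R T"
    using triad unfolding triad_circle_def by blast
  have R: "R > 0" using arc by (simp add: internal_arc_def)
  define k where "k = 1 - \<rho> / r"
  have rho_k: "\<rho> = (1 - k) * r" "\<rho> / r = 1 - k" using \<open>r > 0\<close> by (simp_all add: k_def)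
  have hom: "c - A = (1 - k) *\<^sub>R (I - A)" "P - A = (1 - k) *\<^sub>R (F - A)"
    using inscribed_in_angle_homothetic[OF tri \<open>r > 0\<close> rho I(1,4,3) cin touch Q]
    by (simp_all add: rho_k(2))
  obtain n where n: "inward_normal B C A n"
    using exists_inward_normal[of B C A] tri by (auto simp: rot)
  have nn: "norm n = 1" "n \<bullet> (C - B) = 0" "n \<bullet> (A - B) > 0"
    using n by (auto simp: inward_normal_def)
  define t x y w where "t = tan (\<theta> / 4)" and "x = dist A F" and "y = dist B D" and "w = dist C D"
  have a: "y + w = norm (C - B)"
    using tangent_length(3)[OF I(2)] by (simp add: y_def w_def dist_norm norm_minus_commute)
  have "dist A E = x" "dist B F = y" "dist C E = w"
    using tangent_length(1,2)[OF I(2)] tangent_length(1,2)[OF I(3)] tangent_length(1,2)[OF I(4)]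
    unfolding x_def y_def w_def
    by (metis add_right_cancel power2_eq_iff_nonneg zero_le_dist)+
  then have sides: "dist A B = x + y" "dist A C = x + w" "(dist A I)\<^sup>2 = x\<^sup>2 + r\<^sup>2"
    using tangent_length(3)[OF I(3)] tangent_length(1,3)[OF I(4)] by (auto simp: x_def)
  \<comment> \<open>The frame \<open>e, n\<close> at \<open>D\<close> is the coordinate system of the previous lemmas.\<close>
  define e where "e = (1 / norm (C - B)) *\<^sub>R (C - B)"
  have e: "norm e = 1" "n \<bullet> e = 0" using ne nn by (auto simp: e_def)
  have sq: "(norm (\<alpha> *\<^sub>R e + \<beta> *\<^sub>R n))\<^sup>2 = \<alpha>\<^sup>2 + \<beta>\<^sup>2" for \<alpha> \<beta>
    using norm_add_Pythagorean[of "\<alpha> *\<^sub>R e" "\<beta> *\<^sub>R n"] e nn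
    by (simp add: orthogonal_def inner_commute)
  have Cb: "C - B = (y + w) *\<^sub>R e" using ne by (simp add: e_def a)
  have "D \<in> closed_segment B C" using I(2) by (simp add: touches_side_at_def)
  then obtain u where u: "D = B + u *\<^sub>R (C - B)" "0 \<le> u" by (auto simp: in_segment algebra_simps)
  then have "y = u * norm (C - B)" by (simp add: y_def dist_norm)
  then have BD: "B - D = (- y) *\<^sub>R e" using u(1) ne by (simp add: e_def)
  have "C - D = (C - B) + (B - D)" by simp
  also have "\<dots> = w *\<^sub>R e" unfolding Cb BD by (simp add: algebra_simps)
  finally have CD: "C - D = w *\<^sub>R e" .
  have ID: "I - D = r *\<^sub>R n"
    using inscribed_center_offset[OF n ne(2) \<open>r > 0\<close> _ I(2)] I(1) by (simp add: rot)
  define p h where "p = (A - D) \<bullet> e" and "h = n \<bullet> (A - D)"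
  have "(A - D) - h *\<^sub>R n = (((A - D) - h *\<^sub>R n) \<bullet> e) *\<^sub>R e"
    using e nn(1)
    by (intro orthogonal_in_plane_parallel[of n]) (auto simp: h_def inner_diff_left inner_diff_right inner_commute dot_square_norm)
  also have "((A - D) - h *\<^sub>R n) \<bullet> e = p" using e by (simp add: p_def inner_diff_left)
  finally have AD: "A - D = p *\<^sub>R e + h *\<^sub>R n" by (simp add: algebra_simps)
  have "A - B = (A - D) - (B - D)" by simp
  also have "\<dots> = (p + y) *\<^sub>R e + h *\<^sub>R n" unfolding AD BD by (simp add: algebra_simps)
  finally have AB: "A - B = (p + y) *\<^sub>R e + h *\<^sub>R n" .
  have "A - C = (A - D) - (C - D)" by simp
  also have "\<dots> = (p - w) *\<^sub>R e + h *\<^sub>R n" unfolding AD CD by (simp add: algebra_simps)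
  finally have AC: "A - C = (p - w) *\<^sub>R e + h *\<^sub>R n" .
  have "A - I = (A - D) - (I - D)" by simp
  also have "\<dots> = p *\<^sub>R e + (h - r) *\<^sub>R n" unfolding AD ID by (simp add: algebra_simps)
  finally have AI: "A - I = p *\<^sub>R e + (h - r) *\<^sub>R n" .
  have hpos: "h > 0" using nn(3) unfolding AB using e(2) nn(1)
    by (simp add: inner_add_right dot_square_norm)
  have xr: "x\<^sup>2 + r\<^sup>2 = p\<^sup>2 + (h - r)\<^sup>2"
    using sides(3) unfolding dist_norm AI sq by simp
  have nonneg: "y + w > 0" "x \<ge> 0" "y \<ge> 0" "w \<ge> 0" using ne a by (auto simp: x_def y_def w_def)
  have "(x + y)\<^sup>2 = (p + y)\<^sup>2 + h\<^sup>2" "(x + w)\<^sup>2 = (p - w)\<^sup>2 + h\<^sup>2"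
    unfolding sides(1,2)[symmetric] dist_norm AB AC sq by simp_all
  note coord = incircle_foot_coordinates[OF this xr \<open>r > 0\<close> hpos nonneg]
  have "c - D = (c - A) + (A - D)" by simp
  also have "\<dots> = k *\<^sub>R (A - D) + (1 - k) *\<^sub>R (I - D)" unfolding hom(1) by (simp add: algebra_simps)
  finally have cD: "c - D = (k * p) *\<^sub>R e + (k * h + (1 - k) * r) *\<^sub>R n"
    unfolding AD ID by (simp add: algebra_simps)
  \<comment> \<open>The lowest point of the circle at \<open>A\<close> has height \<open>k h\<close> over \<open>BC\<close>.\<close>
  have "k \<ge> 0"
  proof -
    have "c - \<rho> *\<^sub>R n \<in> cball c \<rho>" using rho nn(1) by (simp add: dist_norm)
    then have "c - \<rho> *\<^sub>R n \<in> convex hull {B, C, A}" using cin by (auto simp: rot)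
    then have "n \<bullet> ((c - \<rho> *\<^sub>R n) - B) \<ge> 0" by (rule triangle_in_halfplane[OF n])
    also have "(c - \<rho> *\<^sub>R n) - B = (c - D) - (B - D) - \<rho> *\<^sub>R n" by simp
    also have "n \<bullet> \<dots> = k * h" unfolding cD BD rho_k(1) using e(2) nn(1)
      by (simp add: inner_add_right inner_diff_right dot_square_norm)
    finally show ?thesis using hpos by (simp add: zero_le_mult_iff)
  qed
  note ctr = internal_arc_center[OF arc n ne(2) th]
  define g where "g = R * cos (\<theta> / 2)"
  have "c - z = (c - D) - (1/2) *\<^sub>R ((B - D) + (C - D)) + g *\<^sub>R n"
    unfolding ctr(1) g_def midpoint_def by (simp add: complex_eq_iff field_simps)
  also have "\<dots> = (k * p - (w - y) / 2) *\<^sub>R e + (k * h + (1 - k) * r + g) *\<^sub>R n"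
    unfolding cD BD CD by (simp add: complex_eq_iff field_simps)
  finally have cz: "c - z = (k * p - (w - y) / 2) *\<^sub>R e + (k * h + (1 - k) * r + g) *\<^sub>R n" .
  have "(dist c z)\<^sup>2 = (R + (1 - k) * r)\<^sup>2"
    using externally_tangent_dist[OF tang rho R] rho_k(1) by simp
  then have eq: "(k * p - (w - y) / 2)\<^sup>2 + (k * h + (1 - k) * r + g)\<^sup>2 = (R + (1 - k) * r)\<^sup>2"
    unfolding dist_norm cz sq .
  note q = tan_quarter_arc(2,3)[OF th, of R, folded t_def ctr(2) a g_def]
  have xk: "x * k = t * r"
    using tangency_factorization[OF coord(1-6) \<open>r > 0\<close> tan_quarter_arc(1)[OF th, folded t_def]
        \<open>k \<ge> 0\<close> q xr eq] .
  have "F \<in> closed_segment A B" using I(4) by (simp add: touches_side_at_def)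
  then obtain l where "F - A = l *\<^sub>R (B - A)" by (auto simp: in_segment algebra_simps)
  then have orth: "orthogonal (I - F) (k *\<^sub>R (F - A))"
    using tangent_radius_orthogonal(1)[OF I(4)] by (simp add: orthogonal_def)
  have "I - P = (I - F) + (F - A) - (P - A)" by simp
  also have "\<dots> = (I - F) + k *\<^sub>R (F - A)" unfolding hom(2) by (simp add: algebra_simps)
  finally have IP: "I - P = (I - F) + k *\<^sub>R (F - A)" .
  have "(dist I P)\<^sup>2 = r\<^sup>2 + (x * k)\<^sup>2"
    unfolding dist_norm IP
    using norm_add_Pythagorean[OF orth] tangent_radius_orthogonal(2)[OF I(4)]
    by (simp add: dist_norm x_def power_mult_distrib norm_minus_commute[of A F] mult.commute)
  also have "\<dots> = (r * sqrt (1 + t\<^sup>2))\<^sup>2"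
    unfolding xk by (simp add: power_mult_distrib algebra_simps)
  finally show ?thesis
    using \<open>r > 0\<close> unfolding t_def by (simp add: power2_eq_iff_nonneg)
qed

lemma touches_side_at_commute: "touches_side_at c r X Y P = touches_side_at c r Y X P"
  by (simp add: touches_side_at_def insert_commute closed_segment_commute)

lemma triad_circle_commute: "triad_circle \<theta> A B C c r = triad_circle \<theta> A C B c r"
  unfolding triad_circle_def internal_arc_def same_side_def
  by (simp add: insert_commute conj_ac)

theorem theorem6p5:
  fixes A B C I ca cb cc :: complex
    and \<theta> ra rb rc :: real
    and Pab Pac Pbc Pba Pca Pcb :: complex
  assumes triangle: "\<not> collinear {A, B, C}"
    and incenter: "is_incenter A B C I"
    and theta: "0 < \<theta>" "\<theta> < 2 * pi"
    and angle_A: "vertex_angle B A C < pi - \<theta> / 2"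
    and angle_B: "vertex_angle C B A < pi - \<theta> / 2"
    and angle_C: "vertex_angle A C B < pi - \<theta> / 2"
    and gamma_a: "triad_circle \<theta> A B C ca ra"
    and gamma_b: "triad_circle \<theta> B C A cb rb"
    and gamma_c: "triad_circle \<theta> C A B cc rc"
    and touch_a: "touches_side_at ca ra A B Pab" "touches_side_at ca ra A C Pac"
    and touch_b: "touches_side_at cb rb B C Pbc" "touches_side_at cb rb B A Pba"
    and touch_c: "touches_side_at cc rc C A Pca" "touches_side_at cc rc C B Pcb"
  shows "\<exists>\<rho>>0. {Pab, Pac, Pbc, Pba, Pca, Pcb} \<subseteq> sphere I \<rho>"
proof -
  obtain r D E F where r: "r > 0" and sub: "cball I r \<subseteq> convex hull {A, B, C}"
    and D: "touches_side_at I r B C D" and E: "touches_side_at I r C A E"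
    and F: "touches_side_at I r A B F"
    using incenter unfolding is_incenter_def by blast
  define \<rho> where "\<rho> = r * sqrt (1 + (tan (\<theta> / 4))\<^sup>2)"
  have perm: "{A, C, B} = {A, B, C}" "{B, C, A} = {A, B, C}" "{B, A, C} = {A, B, C}"
    "{C, A, B} = {A, B, C}" "{C, B, A} = {A, B, C}" by auto
  note [simp] = perm and dist = triad_touch_point_dist[OF _ theta r, folded \<rho>_def]
  note D' = D[unfolded touches_side_at_commute[of I r B C]]
    and E' = E[unfolded touches_side_at_commute[of I r C A]]
    and F' = F[unfolded touches_side_at_commute[of I r A B]]
  have "dist I Pab = \<rho>" using triangle sub by (intro dist[OF _ _ D E' F gamma_a touch_a(1)]) simp_all
  moreover have "dist I Pac = \<rho>"
    using triangle sub gamma_a triad_circle_commute touch_a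
    by (intro dist[OF _ _ D' F E' _ touch_a(2)]) simp_all
  moreover have "dist I Pbc = \<rho>" using triangle sub by (intro dist[OF _ _ E F' D gamma_b touch_b(1)]) simp_all
  moreover have "dist I Pba = \<rho>"
    using triangle sub gamma_b triad_circle_commute
    by (intro dist[OF _ _ E' D F' _ touch_b(2)]) simp_all
  moreover have "dist I Pca = \<rho>" using triangle sub by (intro dist[OF _ _ F D' E gamma_c touch_c(1)]) simp_all
  moreover have "dist I Pcb = \<rho>"
    using triangle sub gamma_c triad_circle_commute
    by (intro dist[OF _ _ F' E D' _ touch_c(2)]) simp_all
  moreover have "\<rho> > 0" using r by (simp add: \<rho>_def add_pos_nonneg)
  ultimately show ?thesis by auto
qed

end
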